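(* Let $p\in\mathbb{N}$, $b>0$, $x_0=1+b$, and let $g_p(x,y)=((x-x_0)^2+y^2)^{-p}$. Let $\operatorname{R}_n[g_p]$ be the quadrature error when computing $\int_0^{2\pi}g_p(\cos t,\sin t)\,\mathrm{d}t$ using the $n$-point trapezoidal rule. Then, for $n\to\infty$, the error is asymptotically given by $$|\operatorname{R}_n[g_p]|\simeq\frac{4\pi}{(p-1)!\,(b^2+2b)^p}\,\frac{n^{p-1}}{(1+b)^n}.$$
   Context: $\mathbb{N}=\{1,2,3,\dots\}$. The notation $a(n)\simeq b(n)$ means asymptotically equal: $\lim_{n\to\infty} a(n)/b(n)=1$. For a $2\pi$-periodic function $f$, the $n$-point trapezoidal rule approximating $\int_0^{2\pi}f(t)\,\mathrm{d}t$ is $\operatorname{Q}_n[f]=\frac{2\pi}{n}\sum_{k=1}^n f(t_k)$ with $t_k=2\pi k/n$, and the quadrature error is $\operatorname{R}_n[f]=\int_0^{2\pi}f(t)\,\mathrm{d}t-\operatorname{Q}_n[f]$. Here $\operatorname{R}_n[g_p]$ is this error for the function $t\mapsto g_p(\cos t,\sin t)$. *)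

theory Defs
  imports "HOL-Analysis.Analysis" "HOL-Library.Landau_Symbols"
begin

definition trapezoidal_rule :: "nat \<Rightarrow> (real \<Rightarrow> real) \<Rightarrow> real" where
  "trapezoidal_rule n f = 2 * pi / real n * (\<Sum>k = 1..n. f (2 * pi * real k / real n))"

definition quadrature_error :: "nat \<Rightarrow> (real \<Rightarrow> real) \<Rightarrow> real" where
  "quadrature_error n f = integral {0..2 * pi} f - trapezoidal_rule n f"

definition pole_fun :: "nat \<Rightarrow> real \<Rightarrow> real \<Rightarrow> real \<Rightarrow> real" where
  "pole_fun p x0 x y = ((x - x0)^2 + y^2) powi (- int p)"

end

theory Submission
  imports Defs "HOL-Real_Asymp.Real_Asymp"
begin

text \<open>
  On the unit circle, with \<open>r = 1/x0 < 1\<close> and \<open>z = r * cis t\<close>, the squared distance to the pole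
  is \<open>x0^2 * |1 - z|^2\<close>, so \<open>pole_fun\<close> equals \<open>r^(2p) * (1-z)^(-p) * cnj ((1-z)^(-p))\<close>.
  Expanding both factors by the negative binomial series, with coefficients
  \<open>a N = ((N+p-1) choose (p-1)) * r^N\<close>, gives an absolutely convergent double series
  \<open>r^(2p) * (\<Sum>j k. a j * a k * cos ((j-k) * t))\<close> (lemma \<open>pole_fun_cosine_series\<close>).

  The trapezoidal rule integrates \<open>cos (m * t)\<close> exactly unless \<open>m\<close> is a nonzero multiple of \<open>n\<close>,
  in which case the frequency \<open>m\<close> is aliased to 0 and the rule returns \<open>2\<pi>\<close> instead of 0.
  Hence the error is minus \<open>2\<pi>\<close> times the sum of the coefficients with \<open>j \<noteq> k\<close> and
  \<open>n dvd j - k\<close> (lemma \<open>cosine_series_aliasing\<close>). By symmetry only \<open>j = k + (l+1) * n\<close> has to be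
  considered, twice. All these terms are nonnegative, so the absolute value of the error is the
  aliased sum itself, with no cancellation to control.

  After division by \<open>n^(p-1) * r^n\<close>, the term with indices \<open>(k,l)\<close> carries a factor \<open>r^(l*n)\<close>; it
  tends to 0 for \<open>l > 0\<close>, and to \<open>((k+p-1) choose (p-1)) * r^(2k) / (p-1)!\<close> for \<open>l = 0\<close>, because
  a binomial coefficient with fixed lower index grows like a monomial. Dominated convergence for
  sums (lemma \<open>aliased_sum_limit\<close>) makes the limit of the sum \<open>(1-r^2)^(-p) / (p-1)!\<close>, again by the
  negative binomial series, and \<open>r^2 / (1-r^2) = 1 / (x0^2-1) = 1 / (b^2+2b)\<close>.
\<close>

section \<open>Aliasing in the trapezoidal rule\<close>

lemma has_integral_cos_period:
  "((\<lambda>t. cos (of_int m * t)) has_integral (if m = 0 then 2 * pi else 0)) {0..2 * pi}"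
proof (cases "m = 0")
  case True
  then show ?thesis
    using has_integral_const_real[of "1::real" 0 "2 * pi"] by simp
next
  case False
  have "((\<lambda>t. cos (of_int m * t)) has_integral
          sin (of_int m * (2 * pi)) / of_int m - sin (of_int m * 0) / of_int m) {0..2 * pi}"
    using False
    by (intro fundamental_theorem_of_calculus)
       (auto intro!: derivative_eq_intros simp flip: has_real_derivative_iff_has_vector_derivative)
  moreover have "sin (of_int m * (2 * pi)) = 0"
    using sin_int_2pin[of m] by (simp add: mult.commute mult.left_commute)
  ultimately show ?thesis using False by simp
qed

text \<open>The nodes turn the cosine into powers of a single \<open>n\<close>-th root of unity, whose geometric sum over
  a full period vanishes unless the root is 1.\<close>

lemma trapezoidal_rule_cos:
  assumes "n > 0"
  shows "trapezoidal_rule n (\<lambda>t. cos (of_int m * t)) = (if int n dvd m then 2 * pi else 0)"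
proof -
  define w where "w = cis (2 * pi * of_int m / of_nat n)"
  have wn: "w ^ n = 1"
  proof -
    have "w ^ n = cis (2 * pi * of_int m)"
      using assms by (simp add: w_def Complex.DeMoivre field_simps)
    then show ?thesis by simp
  qed
  have w1: "w = 1 \<longleftrightarrow> int n dvd m"
  proof
    assume "w = 1"
    then have "cos (2 * pi * of_int m / of_nat n) = 1"
      by (simp add: w_def complex_eq_iff)
    then obtain j :: int where "2 * pi * of_int m / of_nat n = of_int j * 2 * pi"
      using cos_one_2pi_int by auto
    then have "real_of_int m = real_of_int (j * int n)"
      using assms by (simp add: field_simps)
    then have "m = j * int n" by (simp only: of_int_eq_iff)
    then show "int n dvd m" by simp
  next
    assume "int n dvd m"
    then obtain j where "m = int n * j" by auto
    then have "2 * pi * of_int m / of_nat n = 2 * pi * of_int j" using assms by simp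
    then show "w = 1" by (simp add: w_def)
  qed
  have "(\<Sum>k = 1..n. cos (of_int m * (2 * pi * real k / real n))) = Re (\<Sum>k = 1..n. w ^ k)"
    by (simp add: w_def Complex.DeMoivre algebra_simps)
  also have "(\<Sum>k = 1..n. w ^ k) = w * (\<Sum>k<n. w ^ k)"
    by (simp add: sum.atLeast1_atMost_eq sum_distrib_left)
  also have "\<dots> = (if int n dvd m then of_nat n else 0)"
    using w1 wn by (auto simp: sum_gp_strict)
  finally show ?thesis
    using assms by (simp add: trapezoidal_rule_def)
qed

text \<open>Absolute convergence makes the series uniformly convergent, so both the integral and the
  trapezoidal rule act term by term. They agree on every mode except the aliased ones, where the
  difference is \<open>-2\<pi>\<close>. An arbitrary index type with a frequency map, instead of one coefficient
  per frequency, lets the lemma be applied to a double series without collecting equal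
  frequencies first.\<close>

lemma cosine_series_aliasing:
  fixes c :: "'i \<Rightarrow> real" and \<omega> :: "'i \<Rightarrow> int"
  assumes c: "c summable_on I"
    and f: "\<And>t. ((\<lambda>i. c i * cos (of_int (\<omega> i) * t)) has_sum f t) I"
    and n: "n > 0"
  shows "(c has_sum (- quadrature_error n f / (2 * pi))) {i \<in> I. \<omega> i \<noteq> 0 \<and> int n dvd \<omega> i}"
proof -
  define e where "e = (\<lambda>i t. c i * cos (of_int (\<omega> i) * t))"
  have "(\<lambda>i. \<bar>c i\<bar>) summable_on I"
    using c unfolding summable_on_iff_abs_summable_on_real[of c] by simp
  then have "uniform_limit {0..2 * pi} (\<lambda>X t. \<Sum>i\<in>X. e i t) f (finite_subsets_at_top I)"
    using f by (intro Weierstrass_m_test_general'[where M = "\<lambda>i. \<bar>c i\<bar>"])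
      (auto simp: e_def abs_mult mult_left_le)
  then obtain J L where
      J: "\<And>X. ((\<lambda>t. \<Sum>i\<in>X. e i t) has_integral J X) {0..2 * pi}"
      and L: "(f has_integral L) {0..2 * pi}" and JL: "(J \<longlongrightarrow> L) (finite_subsets_at_top I)"
    by (rule uniform_limit_integral) (auto simp: e_def intro!: continuous_intros)
  have e_int: "(e i has_integral c i * (if \<omega> i = 0 then 2 * pi else 0)) {0..2 * pi}" for i
    unfolding e_def by (rule has_integral_mult_right[OF has_integral_cos_period])
  have "J X = (\<Sum>i\<in>X. c i * (if \<omega> i = 0 then 2 * pi else 0))" if "finite X" for X
    by (rule has_integral_unique[OF J has_integral_sum[OF that e_int]])
  then have "((\<lambda>i. c i * (if \<omega> i = 0 then 2 * pi else 0)) has_sum L) I"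
    unfolding has_sum_def
    by (intro Lim_transform_eventually[OF JL] eventually_finite_subsets_at_top_weakI) auto
  then have int: "((\<lambda>i. c i * (if \<omega> i = 0 then 2 * pi else 0)) has_sum integral {0..2 * pi} f) I"
    using L by (simp add: integral_unique)
  (* The rule is a finite linear combination of point evaluations, so it commutes with the sum. *)
  have "((\<lambda>i. \<Sum>k = 1..n. e i (2 * pi * real k / real n)) has_sum
      (\<Sum>k = 1..n. f (2 * pi * real k / real n))) I"
  proof -
    have "(sum (\<lambda>i. e i (2 * pi * real k / real n)) \<longlongrightarrow> f (2 * pi * real k / real n))
        (finite_subsets_at_top I)" for k
      using f[of "2 * pi * real k / real n"] by (simp add: e_def has_sum_def)
    then show ?thesis
      unfolding has_sum_def sum.swap[where B = "{1..n}"] by (rule tendsto_sum)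
  qed
  then have "((\<lambda>i. trapezoidal_rule n (e i)) has_sum trapezoidal_rule n f) I"
    unfolding trapezoidal_rule_def by (rule has_sum_cmult_right)
  moreover have "trapezoidal_rule n (e i) = c i * (if int n dvd \<omega> i then 2 * pi else 0)" for i
    unfolding trapezoidal_rule_cos[OF n, symmetric]
    by (simp add: e_def trapezoidal_rule_def sum_distrib_left algebra_simps)
  ultimately have "((\<lambda>i. c i * (if int n dvd \<omega> i then 2 * pi else 0)) has_sum trapezoidal_rule n f) I"
    by simp
  from has_sum_add[OF this has_sum_uminusI[OF int]]
  have "((\<lambda>i. c i * (if int n dvd \<omega> i then 2 * pi else 0) - c i * (if \<omega> i = 0 then 2 * pi else 0))
      has_sum - quadrature_error n f) I"
    by (simp add: quadrature_error_def)
  from has_sum_divide_const[OF this, of "2 * pi"]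
  show ?thesis
    by (rule has_sum_cong_neutral[THEN iffD1, rotated -1]) auto
qed

section \<open>The cosine series of the integrand\<close>

lemma has_sum_times:
  fixes f :: "'a \<Rightarrow> 'c :: {real_normed_algebra, banach, second_countable_topology}" and g :: "'b \<Rightarrow> 'c"
  assumes f: "(f has_sum F) A" "(\<lambda>x. norm (f x)) summable_on A"
    and g: "(g has_sum G) B" "(\<lambda>y. norm (g y)) summable_on B"
  shows "((\<lambda>(x, y). f x * g y) has_sum F * G) (A \<times> B)"
proof (rule has_sum_SigmaI)
  show "((\<lambda>y. case (x, y) of (x, y) \<Rightarrow> f x * g y) has_sum f x * G) B" for x
    using has_sum_cmult_right[OF g(1)] by simp
  show "((\<lambda>x. f x * G) has_sum F * G) A"
    by (rule has_sum_cmult_left[OF f(1)])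
  have "(\<lambda>(x, y). norm (f x) * norm (g y)) summable_on A \<times> B"
    using f(2) g(2)
    by (intro summable_on_SigmaI[where g = "\<lambda>x. norm (f x) * infsum (\<lambda>y. norm (g y)) B"])
       (auto intro!: has_sum_cmult_right summable_on_cmult_left has_sum_infsum)
  then show "(\<lambda>(x, y). f x * g y) summable_on A \<times> B"
    by (rule abs_summable_summable[OF Infinite_Sum.abs_summable_on_comparison_test'])
       (auto simp: norm_mult_ineq)
qed

text \<open>The generalised binomial series with exponent \<open>-(q+1)\<close>, rewritten by reflecting the upper
  index. Absolute summability comes from the same series at the point \<open>norm z\<close>.\<close>

lemma negative_binomial_has_sum:
  fixes z :: complex
  assumes "norm z < 1"
  shows "(\<lambda>N. norm (of_nat ((N + q) choose q) * z ^ N)) summable_on UNIV"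
    and "((\<lambda>N. of_nat ((N + q) choose q) * z ^ N) has_sum (1 / (1 - z) ^ Suc q)) UNIV"
proof -
  have sums: "(\<lambda>N. of_nat ((N + q) choose q) * z ^ N) sums (1 / (1 - z) ^ Suc q)"
    if "norm z < 1" for z :: complex
  proof -
    have *: "((- of_nat (Suc q)) gchoose N) * (- z) ^ N = of_nat ((N + q) choose q) * z ^ N" for N
    proof -
      have "(of_nat (Suc q) + of_nat N - 1 gchoose N) = (of_nat ((N + q) choose N) :: complex)"
        by (simp add: binomial_gbinomial add.commute)
      moreover have "(N + q) choose N = (N + q) choose q"
        using binomial_symmetric[of N "N + q"] by simp
      ultimately show ?thesis
        unfolding gbinomial_minus power_minus[of z]
        by (simp add: mult_ac left_minus_one_mult_self)
    qed
    have "1 - z \<noteq> 0" using that by auto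
    then have "(1 + - z) powr (- of_nat (Suc q)) = 1 / (1 - z) ^ Suc q"
      using powr_nat'[of "1 - z" "Suc q"] by (simp add: powr_minus inverse_eq_divide del: of_nat_Suc power_Suc)
    then show ?thesis
      using gen_binomial_complex[of "- z" "- of_nat (Suc q)"] that by (simp only: * norm_minus_cancel)
  qed
  have "summable (\<lambda>N. complex_of_real (real ((N + q) choose q) * norm z ^ N))"
    using sums[of "of_real (norm z)"] assms by (simp add: sums_iff)
  then have norm_summable: "summable (\<lambda>N. norm (of_nat ((N + q) choose q) * z ^ N))"
    by (simp only: summable_complex_of_real norm_mult norm_power norm_of_nat)
  then show "((\<lambda>N. of_nat ((N + q) choose q) * z ^ N) has_sum (1 / (1 - z) ^ Suc q)) UNIV"
    using sums[OF assms] by (rule norm_summable_imp_has_sum)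
  from norm_summable show "(\<lambda>N. norm (of_nat ((N + q) choose q) * z ^ N)) summable_on UNIV"
    by (rule summable_nonneg_imp_summable_on) simp
qed

text \<open>Scaling by \<open>x0\<close> moves the pole out of the way: \<open>|x0 - cis t| = x0 * |1 - cis t / x0|\<close>, where now
  \<open>1 / x0\<close> lies inside the unit disc and a power series in \<open>cis t / x0\<close> becomes available.\<close>

lemma pole_fun_eq:
  assumes "x0 > 1"
  shows "pole_fun p x0 (cos t) (sin t) = (1 / x0) ^ (2 * p) * norm (1 / (1 - of_real (1 / x0) * cis t) ^ p) ^ 2"
proof -
  have "norm (1 - of_real (1 / x0) * cis t) ^ 2 = ((cos t - x0)^2 + (sin t)^2) / x0^2"
    using assms unfolding cmod_power2 by (simp add: field_simps power2_eq_square)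
  then have "(cos t - x0)^2 + (sin t)^2 = x0^2 * norm (1 - of_real (1 / x0) * cis t) ^ 2"
    using assms by (simp add: field_simps)
  then show ?thesis
    using assms
    by (simp add: pole_fun_def power_int_minus norm_divide norm_power power_mult_distrib
        power_divide divide_simps flip: power_mult)
      (simp add: mult.commute)
qed

text \<open>The squared modulus is the product of a series with its conjugate; since the whole is real,
  only the cosines survive in the product \<open>cis (j * t) * cis (- k * t)\<close>.\<close>

lemma pole_fun_cosine_series:
  fixes x0 :: real and q :: nat
  assumes "x0 > 1"
  defines "a \<equiv> \<lambda>N. real ((N + q) choose q) * (1 / x0) ^ N"
  shows "((\<lambda>(j, k). (1 / x0) ^ (2 * Suc q) * (a j * a k) * cos (of_int (int j - int k) * t))
            has_sum pole_fun (Suc q) x0 (cos t) (sin t)) UNIV"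
proof -
  define z where "z = of_real (1 / x0) * cis t"
  define A where "A = (\<lambda>N. of_nat ((N + q) choose q) * z ^ N)"
  have z: "norm z < 1"
    using assms by (simp add: z_def norm_mult norm_divide)
  have A: "(A has_sum 1 / (1 - z) ^ Suc q) UNIV" "(\<lambda>N. norm (A N)) summable_on UNIV"
    unfolding A_def using negative_binomial_has_sum[OF z] by auto
  have cnj_A: "((\<lambda>N. cnj (A N)) has_sum cnj (1 / (1 - z) ^ Suc q)) UNIV"
    using A(1) by (simp only: has_sum_cnj_iff)
  have Re_A: "Re (A j * cnj (A k)) = a j * a k * cos (of_int (int j - int k) * t)" for j k
  proof -
    have "A N = of_real (a N) * cis (real N * t)" for N
      by (simp add: A_def a_def z_def power_mult_distrib Complex.DeMoivre power_divide)
    then have "A j * cnj (A k) = of_real (a j * a k) * cis (real j * t - real k * t)"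
      by (simp add: cis_cnj cis_mult mult_ac)
    then show ?thesis by (simp add: algebra_simps)
  qed
  have "((\<lambda>(j, k). A j * cnj (A k)) has_sum of_real (norm (1 / (1 - z) ^ Suc q) ^ 2)) UNIV"
    unfolding complex_norm_square UNIV_Times_UNIV[symmetric]
    using has_sum_times[OF A cnj_A] A(2) by simp
  from has_sum_cmult_right[OF has_sum_Re[OF this], of "(1 / x0) ^ (2 * Suc q)"]
  show ?thesis
    unfolding pole_fun_eq[OF assms(1)]
    by (simp only: z_def[symmetric] case_prod_unfold Re_A Re_complex_of_real mult.assoc)
qed

text \<open>The aliased pairs \<open>(j, k)\<close> split into \<open>k < j\<close> and \<open>j < k\<close>, which contribute equally; the first
  half is parametrised by \<open>j = k + (l + 1) * n\<close>. The two halves turn the \<open>2\<pi>\<close> of the aliasing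
  formula into \<open>4\<pi>\<close>.\<close>

lemma quadrature_error_pole_fun_series:
  fixes x0 :: real and q :: nat
  assumes "x0 > 1" and n: "n > 0"
  defines "a \<equiv> \<lambda>N. real ((N + q) choose q) * (1 / x0) ^ N"
  shows "((\<lambda>(k, l). (1 / x0) ^ (2 * Suc q) * (a k * a (k + Suc l * n))) has_sum
          - quadrature_error n (\<lambda>t. pole_fun (Suc q) x0 (cos t) (sin t)) / (4 * pi)) UNIV"
proof -
  define c where "c = (\<lambda>(j, k). (1 / x0) ^ (2 * Suc q) * (a j * a k))"
  define E where "E = - quadrature_error n (\<lambda>t. pole_fun (Suc q) x0 (cos t) (sin t)) / (2 * pi)"
  define U where "U = {(j, k). k < j \<and> n dvd j - k}"
  define V where "V = {(j, k). j < k \<and> n dvd k - j}"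
  have ser: "((\<lambda>(j, k). c (j, k) * cos (of_int (int j - int k) * t)) has_sum
      pole_fun (Suc q) x0 (cos t) (sin t)) UNIV" for t
    using pole_fun_cosine_series[OF assms(1), of q t] by (simp add: c_def a_def)
  have c: "c summable_on UNIV"
    using has_sum_imp_summable[OF ser[of 0]] by simp
  have "(c has_sum E) {i \<in> UNIV. (\<lambda>(j, k). int j - int k) i \<noteq> 0 \<and> int n dvd (\<lambda>(j, k). int j - int k) i}"
    unfolding E_def using ser n
    by (intro cosine_series_aliasing[OF c]) (simp_all add: case_prod_unfold)
  also have "{i \<in> UNIV. (\<lambda>(j, k). int j - int k) i \<noteq> 0 \<and> int n dvd (\<lambda>(j, k). int j - int k) i} = U \<union> V"
  proof -
    have "int n dvd int j - int k \<longleftrightarrow> n dvd j - k" if "k < j" for j k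
      using that by (simp flip: of_nat_diff)
    moreover have "int n dvd int j - int k \<longleftrightarrow> n dvd k - j" if "j < k" for j k
      using that by (subst dvd_minus_iff[symmetric]) (simp flip: of_nat_diff)
    ultimately show ?thesis
      by (auto simp: U_def V_def) (meson linorder_neqE_nat)+
  qed
  finally have UV: "(c has_sum E) (U \<union> V)" .
  obtain D where D: "(c has_sum D) U"
    using c summable_on_subset_banach[of c UNIV U] by (auto simp: summable_on_def)
  have "(c has_sum D) V"
    using D by (subst has_sum_reindex_bij_witness[of V "\<lambda>(j, k). (k, j)" "\<lambda>(j, k). (k, j)" U c c D D])
      (auto simp: U_def V_def c_def)
  then have "(c has_sum D + D) (U \<union> V)"
    by (intro has_sum_Un_disjoint[OF D]) (auto simp: U_def V_def)
  then have "E = D + D"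
    using UV has_sum_unique by blast
  moreover have "((\<lambda>(k, l). c (k + Suc l * n, k)) has_sum D) UNIV"
  proof (subst has_sum_reindex_bij_witness[of UNIV "\<lambda>(j, k). (k, (j - k) div n - 1)"
        "\<lambda>(k, l). (k + Suc l * n, k)" U c])
    fix i assume "i \<in> U"
    then obtain j k m where i: "i = (j, k)" "k < j" "j - k = n * m"
      by (auto simp: U_def elim!: dvdE)
    then have "m \<noteq> 0" by (intro notI) simp
    then show "(\<lambda>(k, l). (k + Suc l * n, k)) ((\<lambda>(j, k). (k, (j - k) div n - 1)) i) = i"
      using i n by (cases m) (auto simp: mult.commute)
  qed (use D n in \<open>auto simp: U_def\<close>)
  moreover from \<open>E = D + D\<close>
  have "D = - quadrature_error n (\<lambda>t. pole_fun (Suc q) x0 (cos t) (sin t)) / (4 * pi)"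
    by (simp add: E_def field_simps)
  ultimately show ?thesis
    by (simp only: c_def case_prod_conv mult.commute[of "a _" "a _"])
qed

section \<open>Asymptotics of the aliased sum\<close>

text \<open>The dominating series makes the finite partial sums converge uniformly in the parameter, so the
  two limits may be interchanged.\<close>

lemma tendsto_infsum_dominated:
  fixes f :: "'a \<Rightarrow> 'b \<Rightarrow> 'c :: banach"
  assumes lim: "\<And>i. i \<in> I \<Longrightarrow> ((\<lambda>x. f x i) \<longlongrightarrow> g i) F"
    and bound: "\<forall>\<^sub>F x in F. \<forall>i\<in>I. norm (f x i) \<le> M i"
    and M: "M summable_on I"
  shows "((\<lambda>x. infsum (f x) I) \<longlongrightarrow> infsum g I) F"
proof (cases "F = bot")
  case False
  define S where "S = {x. \<forall>i\<in>I. norm (f x i) \<le> M i}"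
  have "norm (g i) \<le> M i" if "i \<in> I" for i
    using False bound that
    by (intro tendsto_upperbound[OF tendsto_norm[OF lim[OF that]]]) (auto elim!: eventually_mono)
  then have "g summable_on I"
    by (rule abs_summable_summable[OF Infinite_Sum.abs_summable_on_comparison_test'[OF M]])
  then have "(sum g \<longlongrightarrow> infsum g I) (finite_subsets_at_top I)"
    by (rule infsum_tendsto)
  moreover have "uniform_limit S (\<lambda>X x. \<Sum>i\<in>X. f x i) (\<lambda>x. infsum (f x) I) (finite_subsets_at_top I)"
    by (rule Weierstrass_m_test_general[OF _ M]) (auto simp: S_def)
  moreover have "\<forall>\<^sub>F X in finite_subsets_at_top I. ((\<lambda>x. \<Sum>i\<in>X. f x i) \<longlongrightarrow> sum g X) F"
    by (intro eventually_finite_subsets_at_top_weakI tendsto_sum lim) auto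
  ultimately show ?thesis
    using bound by (intro swap_uniform_limit'[where S = S]) (auto simp: S_def)
qed simp

text \<open>The binomial coefficient is the product of the factors \<open>(N + i) / i = 1 + N / i\<close> for
  \<open>i = 1, \<dots>, q\<close>, each at most \<open>N + 1\<close>.\<close>

lemma binomial_le_power: "(N + q) choose q \<le> (N + 1) ^ q"
proof (induction q)
  case (Suc q)
  have "Suc q * ((N + Suc q) choose Suc q) = (N + q + 1) * ((N + q) choose q)"
    using Suc_times_binomial_eq[of "N + q" q] by simp
  also have "\<dots> \<le> (Suc q * (N + 1)) * (N + 1) ^ q"
    by (intro mult_mono Suc.IH) (auto simp: algebra_simps)
  finally have "Suc q * ((N + Suc q) choose Suc q) \<le> Suc q * (N + 1) ^ Suc q"
    by (simp only: mult.assoc power_Suc)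
  then show ?case by (simp only: Suc_mult_le_cancel1)
qed simp

lemma binomial_asymptotics:
  "(\<lambda>n. real ((k + m * n + q) choose q) / real n ^ q) \<longlonglongrightarrow> real m ^ q / fact q"
proof -
  have "real ((k + m * n + q) choose q) / real n ^ q
      = (\<Prod>i<q. (real k + real m * real n + 1 + real i) / real n) / fact q" for n
    unfolding binomial_gbinomial gbinomial_pochhammer' pochhammer_prod
    by (simp add: prod_dividef atLeast0LessThan add_ac)
  moreover have "(\<lambda>n. (real k + real m * real n + 1 + real i) / real n) \<longlonglongrightarrow> real m" for i
    by real_asymp
  then have "(\<lambda>n. (\<Prod>i<q. (real k + real m * real n + 1 + real i) / real n) / fact q)
      \<longlonglongrightarrow> (\<Prod>i<q. real m) / fact q"
    by (intro tendsto_intros) auto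
  ultimately show ?thesis by simp
qed

text \<open>Half of the exponential decay absorbs the polynomial factor and the other half remains summable;
  this is why \<open>d\<close> is half the decay rate \<open>- ln r\<close>.\<close>

lemma summable_power_times_geometric:
  fixes r :: real and q :: nat
  assumes "0 < r" "r < 1"
  shows "(\<lambda>k. (real k + c) ^ q * r ^ k) summable_on UNIV"
proof -
  define d where "d = - ln r / 2"
  have d: "d > 0" and r: "r ^ k = exp (- d * real k) * exp (- d * real k)" for k
    using assms by (auto simp: d_def exp_of_nat_mult simp flip: exp_add)
  have geo: "exp (- d) ^ k = exp (- d * real k)" for k
    by (simp add: exp_of_nat_mult[symmetric] mult.commute)
  have "summable (\<lambda>k. norm ((real k + c) ^ q * r ^ k))"
  proof (rule summable_comparison_test_bigo[OF _ landau_o.small_imp_big[OF smalloI_tendsto]])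
    show "summable (\<lambda>k. norm (exp (- d) ^ k))"
      using d by simp
    have "(\<lambda>k. (real k + c) ^ q * exp (- d * real k)) \<longlonglongrightarrow> 0"
      using d by real_asymp
    then have "(\<lambda>k. norm ((real k + c) ^ q * exp (- d * real k))) \<longlonglongrightarrow> 0"
      by (rule tendsto_norm_zero)
    then show "(\<lambda>k. norm ((real k + c) ^ q * r ^ k) / exp (- d) ^ k) \<longlonglongrightarrow> 0"
      unfolding r geo by (simp add: abs_mult mult.assoc[symmetric])
  qed simp
  then show ?thesis
    by (rule norm_summable_imp_summable_on)
qed

text \<open>Dominated convergence in the pair \<open>(k, l)\<close>. In the proof, \<open>T n\<close> is the family of normalised terms,
  \<open>T'\<close> its pointwise limit and \<open>M\<close> a dominating family. Because
  \<open>k + (l+1) * n + 1 \<le> (k+2) * (l+1) * n\<close>, the power of \<open>n\<close> in the normalisation cancels and the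
  bound splits into a factor depending on \<open>k\<close> and one depending on \<open>l\<close>, each polynomial times
  geometric. The powers \<open>(r^l)^n\<close> are bounded by \<open>r^l\<close>, which provides the decay in \<open>l\<close>.\<close>

lemma aliased_sum_limit:
  fixes r :: real and q :: nat
  assumes r: "0 < r" "r < 1"
  defines "a \<equiv> \<lambda>N. real ((N + q) choose q) * r ^ N"
  shows "(\<lambda>n. (\<Sum>\<^sub>\<infinity>(k, l). a k * a (k + Suc l * n)) / (real n ^ q * r ^ n))
           \<longlonglongrightarrow> 1 / (fact q * (1 - r^2) ^ Suc q)"
proof -
  define w where "w = (\<lambda>N. real ((N + q) choose q))"
  define T where "T = (\<lambda>n (k, l). w k * (r^2) ^ k * (w (k + Suc l * n) / real n ^ q) * (r ^ l) ^ n)"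
  define T' where "T' = (\<lambda>(k, l). if l = (0::nat) then w k * (r^2) ^ k / fact q else 0)"
  define M where "M = (\<lambda>(k, l). ((real k + 2) ^ (2 * q) * (r^2) ^ k) * ((real l + 1) ^ q * r ^ l))"
  have w0: "w N \<ge> 0" for N by (simp add: w_def)
  have w_le: "w N \<le> (real N + 1) ^ q" for N
    using binomial_le_power[of N q] unfolding w_def
    by (metis of_nat_1 of_nat_add of_nat_le_iff of_nat_power)
  have r2: "0 < r^2" "r^2 < 1"
    using r by (auto simp: power_less_one_iff)
  have scale: "a k * a (k + Suc l * n) / (real n ^ q * r ^ n) = T n (k, l)" for k l n
    using r by (simp add: a_def w_def T_def power_add field_simps power_mult power2_eq_square power_mult_distrib)
  have "(\<lambda>n. T n i) \<longlonglongrightarrow> T' i" for i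
  proof -
    obtain k l where i: "i = (k, l)" by (cases i)
    have "(\<lambda>n. (r ^ l) ^ n) \<longlonglongrightarrow> (if l = 0 then 1 else 0)"
      using r by (auto intro!: LIMSEQ_power_zero simp: power_less_one_iff)
    then have "(\<lambda>n. T n i) \<longlonglongrightarrow> w k * (r^2) ^ k * (real (Suc l) ^ q / fact q) * (if l = 0 then 1 else 0)"
      unfolding T_def i w_def case_prod_conv by (intro tendsto_intros binomial_asymptotics)
    then show ?thesis by (auto simp: i T'_def split: if_splits)
  qed
  moreover have "norm (T n i) \<le> M i" if "n > 0" for n i
  proof -
    obtain k l where i: "i = (k, l)" by (cases i)
    have "real (k + Suc l * n) + 1 \<le> (real k + 2) * (real l + 1) * real n"
    proof -
      have "1 \<le> Suc l * n"
        using that by simp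
      then have "(k + 1) * 1 \<le> (k + 1) * (Suc l * n)"
        by (rule mult_le_mono2)
      then have "k + Suc l * n + 1 \<le> (k + 2) * (Suc l * n)"
        by simp
      then have "real (k + Suc l * n + 1) \<le> real ((k + 2) * (Suc l * n))"
        by (simp only: of_nat_le_iff)
      also have "\<dots> = (real k + 2) * (real l + 1) * real n"
        by (simp add: algebra_simps)
      finally show ?thesis by simp
    qed
    then have "w (k + Suc l * n) \<le> ((real k + 2) * (real l + 1) * real n) ^ q"
      by (intro order_trans[OF w_le] power_mono) auto
    then have 1: "w (k + Suc l * n) / real n ^ q \<le> (real k + 2) ^ q * (real l + 1) ^ q"
      using that unfolding power_mult_distrib by (simp add: pos_divide_le_eq)
    have 2: "w k \<le> (real k + 2) ^ q"
      by (intro order_trans[OF w_le] power_mono) auto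
    have 3: "(r ^ l) ^ n \<le> r ^ l"
      using r that power_decreasing[of 1 n "r ^ l"] by (simp add: power_le_one)
    have "T n i \<le> (real k + 2) ^ q * (r^2) ^ k * ((real k + 2) ^ q * (real l + 1) ^ q) * r ^ l"
      unfolding i T_def case_prod_conv using r w0 1 2 3
      by (intro mult_mono) auto
    also have "\<dots> = M i"
      unfolding i M_def case_prod_conv mult_2 power_add by (simp only: mult_ac)
    finally show ?thesis
      using r w0 by (simp add: i T_def)
  qed
  then have "\<forall>\<^sub>F n in sequentially. \<forall>i\<in>UNIV. norm (T n i) \<le> M i"
    by (intro eventually_mono[OF eventually_gt_at_top[of 0]]) auto
  moreover have "M summable_on UNIV"
  proof -
    have "M summable_on UNIV \<times> UNIV"
      unfolding M_def using r r2
      by (intro has_sum_imp_summable[OF has_sum_times[OF has_sum_infsum _ has_sum_infsum]])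
        (simp_all add: summable_power_times_geometric abs_mult)
    then show ?thesis by simp
  qed
  ultimately have lim: "(\<lambda>n. infsum (T n) UNIV) \<longlonglongrightarrow> infsum T' UNIV"
    by (intro tendsto_infsum_dominated)
  have "((\<lambda>k. w k * (r^2) ^ k) has_sum 1 / (1 - r^2) ^ Suc q) UNIV"
  proof -
    have "norm (of_real (r^2) :: complex) < 1"
      using r2 unfolding norm_of_real by simp
    from negative_binomial_has_sum(2)[OF this, of q]
    have "((\<lambda>k. complex_of_real (w k * (r^2) ^ k)) has_sum complex_of_real (1 / (1 - r^2) ^ Suc q)) UNIV"
      by (simp add: w_def del: power_Suc)
    then show ?thesis by (simp only: has_sum_of_real_iff)
  qed
  from has_sum_divide_const[OF this, of "fact q"]
  have "(T' has_sum 1 / (1 - r^2) ^ Suc q / fact q) (range (\<lambda>k. (k, 0)))"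
    by (subst has_sum_reindex) (auto simp: inj_on_def T'_def o_def)
  then have "(T' has_sum 1 / (1 - r^2) ^ Suc q / fact q) UNIV"
    by (rule has_sum_cong_neutral[THEN iffD1, rotated -1]) (auto simp: T'_def)
  then have "infsum T' UNIV = 1 / (fact q * (1 - r^2) ^ Suc q)"
    by (simp add: infsumI mult.commute)
  moreover have "infsum (T n) UNIV = (\<Sum>\<^sub>\<infinity>(k, l). a k * a (k + Suc l * n)) / (real n ^ q * r ^ n)" for n
    unfolding divide_inverse infsum_cmult_left'[symmetric]
    by (intro infsum_cong) (auto simp: scale[symmetric] divide_inverse)
  ultimately show ?thesis using lim by simp
qed

section \<open>The asymptotic error\<close>

theorem theorem4:
  fixes p :: nat and b x0 :: real
  assumes "p \<ge> 1" and "b > 0" and "x0 = 1 + b"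
  shows "(\<lambda>n :: nat. \<bar>quadrature_error n (\<lambda>t. pole_fun p x0 (cos t) (sin t))\<bar>)
    \<sim>[at_top]
    (\<lambda>n. 4 * pi / (fact (p - 1) * (b^2 + 2 * b) ^ p) * (real n ^ (p - 1) / (1 + b) ^ n))"
proof -
  obtain q where p: "p = Suc q"
    using assms(1) by (cases p) auto
  define r where "r = 1 / x0"
  have x0: "x0 > 1" and r: "0 < r" "r < 1"
    using assms by (auto simp: r_def)
  define a where "a = (\<lambda>N. real ((N + q) choose q) * r ^ N)"
  define s where "s = (\<lambda>n. \<Sum>\<^sub>\<infinity>(k, l). a k * a (k + Suc l * n))"
  define R where "R = (\<lambda>n. quadrature_error n (\<lambda>t. pole_fun p x0 (cos t) (sin t)))"
  define C where "C = 4 * pi / (fact q * (b^2 + 2 * b) ^ p)"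
  (* This is the limit constant in the form in which the aliased sum produces it. *)
  have C: "C = 4 * pi * r ^ (2 * p) * (1 / (fact q * (1 - r^2) ^ p))"
  proof -
    have "b^2 + 2 * b = x0^2 - 1"
      using assms(3) by (simp add: power2_eq_square algebra_simps)
    also have "\<dots> = (1 - r^2) / r^2"
      using x0 by (simp add: r_def field_simps)
    finally have "b^2 + 2 * b = (1 - r^2) / r^2" .
    then show ?thesis
      by (simp add: C_def power_divide power_mult)
  qed
  have C0: "C \<noteq> 0"
    using assms by (simp add: C_def add_nonneg_eq_0_iff)
  have R: "\<bar>R n\<bar> = 4 * pi * r ^ (2 * p) * s n" if "n > 0" for n
  proof -
    have "- R n / (4 * pi) = (\<Sum>\<^sub>\<infinity>(k, l). r ^ (2 * p) * (a k * a (k + Suc l * n)))"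
      using quadrature_error_pole_fun_series[OF x0 that, of q]
      by (simp add: infsumI R_def p r_def a_def del: power_Suc)
    also have "\<dots> = r ^ (2 * p) * s n"
      unfolding s_def infsum_cmult_right'[symmetric] by (intro infsum_cong) auto
    finally have "R n = - (4 * pi * r ^ (2 * p) * s n)"
      by (simp add: field_simps)
    moreover have "s n \<ge> 0"
      unfolding s_def a_def using r by (intro infsum_nonneg) auto
    ultimately show ?thesis
      using r by (simp add: abs_mult)
  qed
  have norm1: "4 * pi * r ^ (2 * p) / C * (1 / (fact q * (1 - r^2) ^ p)) = 1"
    using C0 by (simp only: times_divide_eq_left C[symmetric] divide_self_if if_False)
  have "(\<lambda>n. s n / (real n ^ q * r ^ n)) \<longlonglongrightarrow> 1 / (fact q * (1 - r^2) ^ p)"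
    unfolding s_def a_def p by (rule aliased_sum_limit[OF r])
  from tendsto_mult_left[OF this, of "4 * pi * r ^ (2 * p) / C"]
  have "(\<lambda>n. 4 * pi * r ^ (2 * p) / C * (s n / (real n ^ q * r ^ n))) \<longlonglongrightarrow> 1"
    unfolding norm1 .
  moreover have "\<forall>\<^sub>F n in sequentially. 4 * pi * r ^ (2 * p) / C * (s n / (real n ^ q * r ^ n))
      = \<bar>R n\<bar> / (C * (real n ^ (p - 1) / (1 + b) ^ n))"
    using eventually_gt_at_top[of 0]
    by eventually_elim (simp add: R p r_def assms(3) power_divide)
  ultimately have "(\<lambda>n. \<bar>R n\<bar> / (C * (real n ^ (p - 1) / (1 + b) ^ n))) \<longlonglongrightarrow> 1"
    by (rule Lim_transform_eventually)
  then show ?thesis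
    unfolding R_def C_def p diff_Suc_1 by (rule asymp_equivI')
qed

end
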